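(* Let $f:I\subset\mathbb{R}\to\mathbb{R}$ be a twice differentiable function on $I^{\circ}$ such that $f''\in L_1[a,b]$, where $a,b\in I$, $a<b$. Let $\alpha,\beta$ be real numbers with $a\le\alpha<\beta\le b$. If $|f''|$ is convex on $[a,b]$, then for any $x\in[a,\frac{a+b}{2}]$, $$\begin{aligned} \Big| & 2\int_a^b f(t)\,dt-(\beta-\alpha)\left[f(x)+f(a+b-x)\right]\\ &+(b-\beta)^2f'(b)-(a-\alpha)^2f'(a)+2(a-\alpha)f(a)-2(b-\beta)f(b)\\ &+(\beta-\alpha)\left[\left(x-\tfrac{3\alpha+\beta}{4}\right)f'(x)+\left(a+b-x-\tfrac{\alpha+3\beta}{4}\right)f'(a+b-x)\right]\Big|\\ &\le \frac{b-a}{4}\,\|k\|_\infty\left[|f''(a)|+|f''(b)|+2\left|f''\!\left(\tfrac{a+b}{2}\right)\right|\right], \end{aligned}$$ where $\|k\|_\infty=\max_{t\in[a,b]}|k(a,b,t)|$ and $k(a,b,t)$ is the kernel (depending on $x,\alpha,\beta$) defined in the context.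
   Context: $I$ is an interval of real numbers and $I^{\circ}$ is its interior. For $a\le\alpha<\beta\le b$ and $x\in[a,\frac{a+b}{2}]$, the kernel is $$k(a,b,t)=\begin{cases}(t-\alpha)^2, & a\le t<x,\\ \left(t-\frac{\alpha+\beta}{2}\right)^2, & x\le t<a+b-x,\\ (t-\beta)^2, & a+b-x\le t\le b.\end{cases}$$ *)

theory Defs
  imports "HOL-Analysis.Analysis"
begin

definition kernel :: "real \<Rightarrow> real \<Rightarrow> real \<Rightarrow> real \<Rightarrow> real \<Rightarrow> real \<Rightarrow> real" where
  "kernel \<alpha> \<beta> x a b t =
     (if t < x then (t - \<alpha>)\<^sup>2
      else if t < a + b - x then (t - (\<alpha> + \<beta>) / 2)\<^sup>2
      else (t - \<beta>)\<^sup>2)"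

text \<open>
  The uniform norm on $[a,b]$ is a supremum: the kernel is discontinuous, and its one-sided limits at
  $x$ and $a+b-x$ need not be attained as values, so a maximum need not exist.
\<close>

definition kernel_norm :: "real \<Rightarrow> real \<Rightarrow> real \<Rightarrow> real \<Rightarrow> real \<Rightarrow> real" where
  "kernel_norm \<alpha> \<beta> x a b = (SUP t\<in>{a..b}. \<bar>kernel \<alpha> \<beta> x a b t\<bar>)"

end

theory Submission imports Defs begin

text \<open>
  On each interval where the kernel is a single square $(t-c)^2$, two integrations by parts rewrite
  $\int (t-c)^2 f''(t)\,dt$ as $2\int f$ plus boundary terms. Adding up the three pieces turns the
  left-hand side into $|\int_a^b k(a,b,t) f''(t)\,dt| \le \|k\|_\infty \int_a^b |f''|$, and the last
  integral is bounded by applying the trapezoid half of the Hermite--Hadamard inequality to the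
  convex function $|f''|$ on each half of $[a,b]$.
\<close>

text \<open>A convex function lies below its chord, here the line through the end values with slope
  \<open>s\<close>, and the area under that chord is the trapezoid area on the right.\<close>

lemma trapezoid_bound_convex:
  fixes g :: "real \<Rightarrow> real"
  assumes convex: "convex_on {p..q} g" and integrable: "g integrable_on {p..q}" and "p < q"
  shows "integral {p..q} g \<le> (q - p) / 2 * (g p + g q)"
proof -
  define s where "s = (g q - g p) / (q - p)"
  have "((\<lambda>t. s * (t - p) + g p) has_integral
      (s * (q - p)\<^sup>2 / 2 + g p * q) - (s * (p - p)\<^sup>2 / 2 + g p * p)) {p..q}"
    using \<open>p < q\<close>
    by (intro fundamental_theorem_of_calculus)
       (auto simp flip: has_real_derivative_iff_has_vector_derivative
             intro!: derivative_eq_intros simp: field_simps)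
  moreover have "(s * (q - p)\<^sup>2 / 2 + g p * q) - (s * (p - p)\<^sup>2 / 2 + g p * p)
      = (q - p) / 2 * (g p + g q)"
    using \<open>p < q\<close> by (simp add: s_def power2_eq_square) (simp add: field_simps)
  ultimately have chord: "((\<lambda>t. s * (t - p) + g p) has_integral (q - p) / 2 * (g p + g q)) {p..q}"
    by (simp only:)
  have "g t \<le> s * (t - p) + g p" if "t \<in> {p..q}" for t
    using convex_onD_Icc'[OF convex that] by (simp add: s_def)
  with has_integral_le[OF integrable_integral[OF integrable] chord] show ?thesis
    by blast
qed

text \<open>Both integrations by parts are done at once: $(t-c)^2 f'(t) - 2(t-c) f(t)$ is an
  antiderivative of $(t-c)^2 f''(t) - 2 f(t)$. The fundamental theorem thus yields integrability as
  well as the value, and the continuous part $2f$ is added back afterwards.\<close>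

lemma square_integral_by_parts_twice:
  fixes f f' f'' :: "real \<Rightarrow> real"
  assumes "p \<le> q"
    and f: "\<And>t. t \<in> {p..q} \<Longrightarrow> (f has_real_derivative f' t) (at t within {p..q})"
    and f': "\<And>t. t \<in> {p..q} \<Longrightarrow> (f' has_real_derivative f'' t) (at t within {p..q})"
  shows "((\<lambda>t. (t - c)\<^sup>2 * f'' t) has_integral
      ((q - c)\<^sup>2 * f' q - 2 * (q - c) * f q) - ((p - c)\<^sup>2 * f' p - 2 * (p - c) * f p)
      + 2 * integral {p..q} f) {p..q}"
proof -
  have "((\<lambda>t. (t - c)\<^sup>2 * f'' t - 2 * f t) has_integral
      ((q - c)\<^sup>2 * f' q - 2 * (q - c) * f q) - ((p - c)\<^sup>2 * f' p - 2 * (p - c) * f p)) {p..q}"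
    using \<open>p \<le> q\<close>
    by (intro fundamental_theorem_of_calculus)
       (auto simp flip: has_real_derivative_iff_has_vector_derivative
             intro!: derivative_eq_intros f f' simp: algebra_simps)
  moreover have "f integrable_on {p..q}"
    by (intro integrable_continuous_real DERIV_continuous_on[OF f])
  then have "((\<lambda>t. 2 * f t) has_integral 2 * integral {p..q} f) {p..q}"
    by (intro has_integral_mult_right integrable_integral)
  ultimately show ?thesis
    by (auto dest: has_integral_add)
qed

lemma abs_kernel_le_kernel_norm:
  assumes "{\<alpha>, \<beta>} \<subseteq> {a..b}" and "t \<in> {a..b}"
  shows "\<bar>kernel \<alpha> \<beta> x a b t\<bar> \<le> kernel_norm \<alpha> \<beta> x a b"
proof -
  have sq: "(s - c)\<^sup>2 \<le> (b - a)\<^sup>2" if "s \<in> {a..b}" "c \<in> {a..b}" for s c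
    using that by (intro abs_le_square_iff[THEN iffD1]) auto
  have "\<bar>kernel \<alpha> \<beta> x a b s\<bar> \<le> (b - a)\<^sup>2" if "s \<in> {a..b}" for s
    using assms(1) sq[OF that, of \<alpha>] sq[OF that, of \<beta>] sq[OF that, of "(\<alpha> + \<beta>) / 2"]
    by (simp add: kernel_def)
  then have "bdd_above ((\<lambda>s. \<bar>kernel \<alpha> \<beta> x a b s\<bar>) ` {a..b})"
    by (intro bdd_aboveI[of _ "(b - a)\<^sup>2"]) auto
  then show ?thesis
    unfolding kernel_norm_def using assms(2) by (rule cSUP_upper2) simp
qed

lemma has_integral_kernel:
  fixes f f' f'' :: "real \<Rightarrow> real"
  assumes f: "\<And>t. t \<in> {a..b} \<Longrightarrow> (f has_real_derivative f' t) (at t within {a..b})"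
    and f': "\<And>t. t \<in> {a..b} \<Longrightarrow> (f' has_real_derivative f'' t) (at t within {a..b})"
    and x: "x \<in> {a..(a + b) / 2}"
  shows "((\<lambda>t. kernel \<alpha> \<beta> x a b t * f'' t) has_integral
      2 * integral {a..b} f - (\<beta> - \<alpha>) * (f x + f (a + b - x))
      + (b - \<beta>)\<^sup>2 * f' b - (a - \<alpha>)\<^sup>2 * f' a
      + 2 * (a - \<alpha>) * f a - 2 * (b - \<beta>) * f b
      + (\<beta> - \<alpha>) * ((x - (3 * \<alpha> + \<beta>) / 4) * f' x
                   + (a + b - x - (\<alpha> + 3 * \<beta>) / 4) * f' (a + b - x))) {a..b}"
proof -
  let ?k = "kernel \<alpha> \<beta> x a b"
  define y where "y = a + b - x"
  have order: "a \<le> x" "x \<le> y" "y \<le> b"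
    using x by (auto simp: y_def)
  \<comment> \<open>Agreement with the square is asked for on the open interval only, because at
    \<open>q\<close> the kernel may already follow its next branch; two points do not affect the
    integral. Allowing \<open>p = q\<close> covers $x = a$ and $x = (a+b)/2$.\<close>
  have piece: "((\<lambda>t. ?k t * f'' t) has_integral
      ((q - c)\<^sup>2 * f' q - 2 * (q - c) * f q) - ((p - c)\<^sup>2 * f' p - 2 * (p - c) * f p)
      + 2 * integral {p..q} f) {p..q}"
    if "a \<le> p" "p \<le> q" "q \<le> b" and k: "\<And>t. p < t \<Longrightarrow> t < q \<Longrightarrow> ?k t = (t - c)\<^sup>2" for p q c
  proof (rule has_integral_spike_finite)
    show "((\<lambda>t. (t - c)\<^sup>2 * f'' t) has_integral
      ((q - c)\<^sup>2 * f' q - 2 * (q - c) * f q) - ((p - c)\<^sup>2 * f' p - 2 * (p - c) * f p)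
      + 2 * integral {p..q} f) {p..q}"
      using that(1-3)
      by (intro square_integral_by_parts_twice DERIV_subset[OF f] DERIV_subset[OF f']) auto
    show "finite {p, q}" by simp
    show "?k t * f'' t = (t - c)\<^sup>2 * f'' t" if "t \<in> {p..q} - {p, q}" for t
      using that k by auto
  qed
  note left = piece[of a x \<alpha>] and middle = piece[of x y "(\<alpha> + \<beta>) / 2"] and right = piece[of y b \<beta>]
  have sum: "((\<lambda>t. ?k t * f'' t) has_integral
      (((x - \<alpha>)\<^sup>2 * f' x - 2 * (x - \<alpha>) * f x) - ((a - \<alpha>)\<^sup>2 * f' a - 2 * (a - \<alpha>) * f a)
        + 2 * integral {a..x} f)
      + (((y - (\<alpha> + \<beta>) / 2)\<^sup>2 * f' y - 2 * (y - (\<alpha> + \<beta>) / 2) * f y)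
         - ((x - (\<alpha> + \<beta>) / 2)\<^sup>2 * f' x - 2 * (x - (\<alpha> + \<beta>) / 2) * f x)
        + 2 * integral {x..y} f)
      + (((b - \<beta>)\<^sup>2 * f' b - 2 * (b - \<beta>) * f b) - ((y - \<beta>)\<^sup>2 * f' y - 2 * (y - \<beta>) * f y)
        + 2 * integral {y..b} f)) {a..b}"
    using order
    by (intro has_integral_combine[of a y b] has_integral_combine[of a x y] left middle right)
       (auto simp: kernel_def y_def)
  have "f integrable_on {a..b}"
    by (intro integrable_continuous_real DERIV_continuous_on[OF f])
  moreover from this have "f integrable_on {a..y}"
    by (rule integrable_on_subinterval) (use order in auto)
  ultimately have "integral {a..b} f = integral {a..x} f + integral {x..y} f + integral {y..b} f"
    using order by (simp add: Henstock_Kurzweil_Integration.integral_combine)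
  then show ?thesis
    unfolding y_def[symmetric]
    by (intro has_integral_eq_rhs[OF sum])
       (simp only:, simp add: algebra_simps power2_eq_square add_divide_distrib diff_divide_distrib)
qed

lemma integral_convex_le_two_trapezoids:
  fixes g :: "real \<Rightarrow> real"
  assumes convex: "convex_on {a..b} g" and integrable: "g integrable_on {a..b}" and "a < b"
  shows "integral {a..b} g \<le> (b - a) / 4 * (g a + g b + 2 * g ((a + b) / 2))"
proof -
  define m where "m = (a + b) / 2"
  have m: "a < m" "m < b" "m - a = (b - a) / 2" "b - m = (b - a) / 2"
    using \<open>a < b\<close> by (auto simp: m_def field_simps)
  have half: "integral {p..q} g \<le> (q - p) / 2 * (g p + g q)" if "a \<le> p" "p < q" "q \<le> b" for p q
    using that by (intro trapezoid_bound_convex convex_on_subset[OF convex]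
      integrable_on_subinterval[OF integrable]) auto
  have "integral {a..b} g = integral {a..m} g + integral {m..b} g"
    using m integrable by (simp add: Henstock_Kurzweil_Integration.integral_combine)
  also have "\<dots> \<le> (m - a) / 2 * (g a + g m) + (b - m) / 2 * (g m + g b)"
    using m by (intro add_mono half) auto
  also have "\<dots> = (b - a) / 4 * (g a + g b + 2 * g m)"
    unfolding m(3,4) by (simp add: field_simps)
  finally show ?thesis
    by (simp add: m_def)
qed

theorem theorem2:
  fixes f f' f'' :: "real \<Rightarrow> real" and I :: "real set" and a b \<alpha> \<beta> x :: real
  assumes "is_interval I"
    and "a \<in> I" and "b \<in> I" and "a < b"
    and "\<And>t. t \<in> interior I \<Longrightarrow> (f has_real_derivative f' t) (at t)"
    and "\<And>t. t \<in> interior I \<Longrightarrow> (f' has_real_derivative f'' t) (at t)"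
    (* if a or b is an end point of I, its derivatives are one-sided; otherwise this is implied *)
    and "\<And>t. t \<in> {a, b} \<Longrightarrow> (f has_real_derivative f' t) (at t within I)"
    and "\<And>t. t \<in> {a, b} \<Longrightarrow> (f' has_real_derivative f'' t) (at t within I)"
    and "f'' absolutely_integrable_on {a..b}"
    and "a \<le> \<alpha>" and "\<alpha> < \<beta>" and "\<beta> \<le> b"
    and "convex_on {a..b} (\<lambda>t. \<bar>f'' t\<bar>)"
    and "x \<in> {a..(a + b) / 2}"
  shows "\<bar>2 * integral {a..b} f - (\<beta> - \<alpha>) * (f x + f (a + b - x))
          + (b - \<beta>)\<^sup>2 * f' b - (a - \<alpha>)\<^sup>2 * f' a
          + 2 * (a - \<alpha>) * f a - 2 * (b - \<beta>) * f b
          + (\<beta> - \<alpha>) * ((x - (3 * \<alpha> + \<beta>) / 4) * f' x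
                       + (a + b - x - (\<alpha> + 3 * \<beta>) / 4) * f' (a + b - x))\<bar>
         \<le> (b - a) / 4 * kernel_norm \<alpha> \<beta> x a b
             * (\<bar>f'' a\<bar> + \<bar>f'' b\<bar> + 2 * \<bar>f'' ((a + b) / 2)\<bar>)"
proof -
  have "{a..b} \<subseteq> I"
    using assms(1-3) by (meson atLeastAtMost_iff is_interval_1 subsetI)
  then have "{a<..<b} \<subseteq> interior I"
    by (intro interior_maximal) auto
  \<comment> \<open>Two-sided derivatives inside and derivatives within \<open>I\<close> at
    \<open>a\<close> and \<open>b\<close> both restrict to derivatives within $[a,b]$. The claim is
    stated for a generic \<open>g\<close> so that it serves for \<open>f\<close> and for
    \<open>f'\<close>.\<close>
  have within: "(g has_real_derivative g' t) (at t within {a..b})"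
    if "\<And>t. t \<in> interior I \<Longrightarrow> (g has_real_derivative g' t) (at t)"
      and "\<And>t. t \<in> {a, b} \<Longrightarrow> (g has_real_derivative g' t) (at t within I)"
      and "t \<in> {a..b}" for g g' t
  proof (cases "t \<in> {a, b}")
    case True
    then show ?thesis
      by (intro DERIV_subset[OF that(2) \<open>{a..b} \<subseteq> I\<close>])
  next
    case False
    with \<open>t \<in> {a..b}\<close> have "t \<in> {a<..<b}"
      by auto
    with \<open>{a<..<b} \<subseteq> interior I\<close> have "t \<in> interior I"
      by (rule subsetD)
    then show ?thesis
      by (rule has_field_derivative_at_within[OF that(1)])
  qed
  have f: "(f has_real_derivative f' t) (at t within {a..b})" if "t \<in> {a..b}" for t
    by (rule within[OF _ _ that]) (fact assms)+
  have f': "(f' has_real_derivative f'' t) (at t within {a..b})" if "t \<in> {a..b}" for t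
    by (rule within[OF _ _ that]) (fact assms)+
  let ?k = "kernel \<alpha> \<beta> x a b" and ?N = "kernel_norm \<alpha> \<beta> x a b"
  let "\<bar>?L\<bar> \<le> _" = ?thesis
  have kernel_int: "((\<lambda>t. ?k t * f'' t) has_integral ?L) {a..b}"
    using f f' \<open>x \<in> {a..(a + b) / 2}\<close> by (rule has_integral_kernel)
  have abs_int: "(\<lambda>t. \<bar>f'' t\<bar>) integrable_on {a..b}"
    using assms(9) by (simp add: absolutely_integrable_on_def)
  have k_le: "\<bar>?k t\<bar> \<le> ?N" if "t \<in> {a..b}" for t
    using that assms(10-12) by (intro abs_kernel_le_kernel_norm) auto
  \<comment> \<open>The supremum dominates the absolute value of the kernel at \<open>a\<close>. The
    sign is what allows the bound on the integral of $|f''|$ to be multiplied by \<open>?N\<close>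
    at the end.\<close>
  have "0 \<le> ?N"
    using k_le[of a] \<open>a < b\<close> by (intro order_trans[OF abs_ge_zero]) auto
  have "\<bar>integral {a..b} (\<lambda>t. ?k t * f'' t)\<bar> \<le> integral {a..b} (\<lambda>t. ?N * \<bar>f'' t\<bar>)"
    unfolding real_norm_def[symmetric]
    using kernel_int abs_int k_le
    by (intro integral_norm_bound_integral)
       (auto simp: abs_mult intro: integrable_on_mult_right mult_right_mono)
  also have "\<dots> = ?N * integral {a..b} (\<lambda>t. \<bar>f'' t\<bar>)"
    by simp
  also have "\<dots> \<le> ?N * ((b - a) / 4 * (\<bar>f'' a\<bar> + \<bar>f'' b\<bar> + 2 * \<bar>f'' ((a + b) / 2)\<bar>))"
    using \<open>0 \<le> ?N\<close> integral_convex_le_two_trapezoids[OF assms(13) abs_int \<open>a < b\<close>]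
    by (rule mult_left_mono[rotated])
  finally show ?thesis
    unfolding integral_unique[OF kernel_int] by (simp only: mult_ac)
qed

end
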